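(* Let $n,k \in \mathbb{N}$ with $n \geqslant 13k - 15$. Then $m(n,3,2,k) = n - k + 1$.
   Context: An $r$-colouring of the complete graph $K_n$ ($n \geqslant 2$) is any function $f: E(K_n) \to [r] = \{1,\dots,r\}$. For a subgraph $H \subseteq K_n$, $c_f(H) = |f(E(H))|$ is the number of distinct colours on edges of $H$. A graph on at least $k+1$ vertices is $k$-connected if deleting any at most $k-1$ vertices leaves a connected graph. $M(f,n,r,s,k)$ is the maximum number of vertices of a $k$-connected subgraph $H \subseteq K_n$ with $c_f(H) \leqslant s$ (taken to be $0$ if no such subgraph exists), and $m(n,r,s,k) = \min_f M(f,n,r,s,k)$, the minimum over all $r$-colourings $f$ of $E(K_n)$. *)

theory Defs
  imports Main "HOL-Library.FuncSet"
begin

text \<open>A finite simple graph is a pair \<open>(V, E)\<close> of a vertex set and a set of two-element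
  subsets of it.\<close>

type_synonym 'a graph = "'a set \<times> 'a set set"

definition verts :: "'a graph \<Rightarrow> 'a set" where
  "verts G = fst G"

definition edges :: "'a graph \<Rightarrow> 'a set set" where
  "edges G = snd G"

definition complete_graph :: "nat \<Rightarrow> nat graph" where
  "complete_graph n = ({1..n}, {e. e \<subseteq> {1..n} \<and> card e = 2})"

text \<open>Subgraphs need not be induced; the last conjunct says that \<open>H\<close> is itself a graph.\<close>

definition is_subgraph :: "'a graph \<Rightarrow> 'a graph \<Rightarrow> bool" where
  "is_subgraph H G \<longleftrightarrow>
     verts H \<subseteq> verts G \<and> edges H \<subseteq> edges G \<and> (\<forall>e\<in>edges H. e \<subseteq> verts H)"

definition delete_verts :: "'a graph \<Rightarrow> 'a set \<Rightarrow> 'a graph" where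
  "delete_verts G S = (verts G - S, {e \<in> edges G. e \<inter> S = {}})"

definition connected_graph :: "'a graph \<Rightarrow> bool" where
  "connected_graph G \<longleftrightarrow>
     verts G \<noteq> {} \<and> (\<forall>u\<in>verts G. \<forall>v\<in>verts G. (u, v) \<in> {(x, y). {x, y} \<in> edges G}\<^sup>*)"

text \<open>The condition \<open>card S < k\<close> expresses ``at most \<open>k - 1\<close> vertices'' without truncated
  subtraction.\<close>

definition k_connected :: "nat \<Rightarrow> 'a graph \<Rightarrow> bool" where
  "k_connected k G \<longleftrightarrow>
     k + 1 \<le> card (verts G) \<and>
     (\<forall>S \<subseteq> verts G. card S < k \<longrightarrow> connected_graph (delete_verts G S))"

text \<open>Values of a colouring outside the edge set are unconstrained, and play no role.\<close>

definition colourings :: "nat \<Rightarrow> nat \<Rightarrow> (nat set \<Rightarrow> nat) set" where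
  "colourings n r = edges (complete_graph n) \<rightarrow> {1..r}"

definition num_colours :: "('a set \<Rightarrow> nat) \<Rightarrow> 'a graph \<Rightarrow> nat" where
  "num_colours f H = card (f ` edges H)"

definition admissible :: "(nat set \<Rightarrow> nat) \<Rightarrow> nat \<Rightarrow> nat \<Rightarrow> nat \<Rightarrow> nat graph set" where
  "admissible f n s k =
     {H. is_subgraph H (complete_graph n) \<and> k_connected k H \<and> num_colours f H \<le> s}"

text \<open>The number of colours \<open>r\<close> enters the maximum only through the colouring \<open>f\<close>.\<close>

definition max_order :: "(nat set \<Rightarrow> nat) \<Rightarrow> nat \<Rightarrow> nat \<Rightarrow> nat \<Rightarrow> nat" where
  "max_order f n s k =
     (if admissible f n s k = {} then 0
      else Max ((\<lambda>H. card (verts H)) ` admissible f n s k))"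

definition min_max_order :: "nat \<Rightarrow> nat \<Rightarrow> nat \<Rightarrow> nat \<Rightarrow> nat" where
  "min_max_order n r s k = Min ((\<lambda>f. max_order f n s k) ` colourings n r)"

text \<open>The maximum and the minimum above range over finite sets, the minimum over a nonempty one
  as soon as there is at least one colour.\<close>

lemma card_verts_admissible:
  assumes "H \<in> admissible f n s k"
  shows "card (verts H) \<le> n"
proof -
  have "verts H \<subseteq> {1..n}"
    using assms by (simp add: admissible_def is_subgraph_def complete_graph_def verts_def)
  then have "card (verts H) \<le> card {1..n}"
    by (intro card_mono) auto
  then show ?thesis
    by simp
qed

lemma finite_orders: "finite ((\<lambda>H. card (verts H)) ` admissible f n s k)"
  by (rule finite_subset[of _ "{..n}"]) (auto dest: card_verts_admissible)

lemma max_order_le: "max_order f n s k \<le> n"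
  by (auto simp: max_order_def finite_orders dest: card_verts_admissible)

lemma finite_max_orders: "finite ((\<lambda>f. max_order f n s k) ` colourings n r)"
  by (rule finite_subset[of _ "{..n}"]) (auto simp: max_order_le)

lemma colourings_nonempty: "1 \<le> r \<Longrightarrow> colourings n r \<noteq> {}"
  by (auto simp: colourings_def Pi_eq_empty)

end

(* Lower bound.  Fix a colour c and a set U of fewer than k vertices, each sending fewer than k
   edges of colours other than c out of U.  If the graph of the other two colours on the
   complement of U is not k-connected, fewer than k vertices S cut it into parts A and B, and all
   edges between A and B have colour c.  If both parts have at least k vertices, colour c alone is
   k-connected on the complement of S.  Otherwise the smaller part can be added to U.  Hence, if
   there is no large k-connected subgraph, each colour c has such a set U c with k to 2k - 2
   vertices.  These three sets are disjoint, and an edge between U c and U d has a colour other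
   than c or a colour other than d.  Counting the edges between them gives
   k (sum of |U c|) <= (k - 1) (sum of |U c|), a contradiction.

   Upper bound.  Three disjoint sets X1, X2, X3 of k - 1 vertices each are coloured cyclically, so
   that a vertex of Xi has only k - 1 edges of colours other than i.  A k-connected subgraph that
   avoids colour i then avoids Xi. *)

theory Submission
  imports Defs
begin

section \<open>Connectivity and degrees\<close>

lemma connected_graph_hub:
  assumes "h \<in> verts G" and "\<And>v. v \<in> verts G \<Longrightarrow> (v, h) \<in> {(x, y). {x, y} \<in> edges G}\<^sup>*"
  shows "connected_graph G"
proof -
  let ?R = "{(x, y). {x, y} \<in> edges G}"
  have "sym ?R"
    by (auto simp: sym_def insert_commute)
  then have "sym (?R\<^sup>*)"
    by (rule sym_rtrancl)
  then show ?thesis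
    using assms unfolding connected_graph_def sym_def by (blast intro: rtrancl_trans)
qed

text \<open>Deleting all neighbours of \<open>v\<close> isolates it, and with at least
  \<open>k + 1\<close> vertices another one survives if fewer than \<open>k\<close> are deleted.
  Removing \<open>v\<close> from its own neighbourhood discounts a singleton edge
  \<open>{v}\<close>, which the hypotheses allow.\<close>

lemma k_connected_degree:
  assumes "k_connected k G" and "finite (verts G)" and "\<forall>e\<in>edges G. e \<subseteq> verts G"
    and "v \<in> verts G"
  shows "k \<le> card ({w. {v, w} \<in> edges G} - {v})"
proof (rule ccontr)
  let ?N = "{w. {v, w} \<in> edges G} - {v}"
  let ?D = "delete_verts G ?N"
  assume "\<not> k \<le> card ?N"
  then have less: "card ?N < k" by simp
  have sub: "?N \<subseteq> verts G" using assms(3) by auto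
  have "connected_graph ?D"
    using assms(1) sub less unfolding k_connected_def by blast
  have "finite ?N" using sub assms(2) by (rule finite_subset)
  then have "card (insert v ?N) = Suc (card ?N)" by (rule card_insert_disjoint) simp
  then have "card (insert v ?N) \<le> k" using less by linarith
  moreover have "k + 1 \<le> card (verts G)" using assms(1) by (simp add: k_connected_def)
  ultimately have "\<not> verts G \<subseteq> insert v ?N"
    using card_mono[of "insert v ?N" "verts G"] finite_subset[OF sub assms(2)] by auto
  then obtain w where w: "w \<in> verts G" "w \<noteq> v" "w \<notin> ?N" by blast
  have "(v, w) \<in> {(x, y). {x, y} \<in> edges ?D}\<^sup>*"
    using \<open>connected_graph ?D\<close> w assms(4)
    by (auto simp: connected_graph_def delete_verts_def verts_def)
  moreover have "y = v" if "(v, y) \<in> {(x, y). {x, y} \<in> edges ?D}\<^sup>*" for y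
    using that
  proof (induction rule: rtrancl_induct)
    case (step y z)
    then show ?case by (auto simp: delete_verts_def edges_def)
  qed simp
  ultimately show False using w(2) by blast
qed

lemma not_k_connected_cut:
  assumes "\<not> k_connected k (W, E)" and "k + 1 \<le> card W"
  obtains S A B where "S \<subseteq> W" "card S < k" "A \<union> B = W - S" "A \<inter> B = {}" "A \<noteq> {}"
    "card A \<le> card B" "\<forall>a\<in>A. \<forall>b\<in>B. {a, b} \<notin> E"
proof -
  obtain S where S: "S \<subseteq> W" "card S < k" "\<not> connected_graph (delete_verts (W, E) S)"
    using assms(1,2) by (auto simp: k_connected_def verts_def)
  let ?R = "{(x, y). {x, y} \<in> {e \<in> E. e \<inter> S = {}}}"
  \<comment> \<open>\<open>connected_graph\<close> also fails for an empty vertex set; the size of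
    \<open>W\<close> excludes this, so there are two vertices without a path between them.\<close>
  have "\<not> W \<subseteq> S"
    using S(1,2) assms(2) by auto
  then obtain u v where uv: "u \<in> W - S" "v \<in> W - S" "(u, v) \<notin> ?R\<^sup>*"
    using S(3) by (auto simp: connected_graph_def delete_verts_def verts_def edges_def)
  define A where "A = {x \<in> W - S. (u, x) \<in> ?R\<^sup>*}"
  define B where "B = (W - S) - A"
  have AB: "A \<union> B = W - S" "A \<inter> B = {}" "A \<noteq> {}" "B \<noteq> {}"
    using uv by (auto simp: A_def B_def)
  have no: "{a, b} \<notin> E" if "a \<in> A" "b \<in> B" for a b
  proof
    assume "{a, b} \<in> E"
    then have "(a, b) \<in> ?R" using that by (auto simp: A_def B_def)
    then have "(u, b) \<in> ?R\<^sup>*" using that(1) by (auto simp: A_def intro: rtrancl_into_rtrancl)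
    then show False using that(2) by (auto simp: A_def B_def)
  qed
  show thesis
  proof (cases "card A \<le> card B")
    case True
    then show thesis using that[of S A B] S AB no by blast
  next
    case False
    then show thesis using that[of S B A] S AB no
      by (metis Int_commute Un_commute insert_commute nat_le_linear)
  qed
qed

section \<open>The lower bound\<close>

definition nearly_mono :: "('a set \<Rightarrow> nat) \<Rightarrow> 'a set \<Rightarrow> nat \<Rightarrow> nat \<Rightarrow> 'a set \<Rightarrow> bool" where
  "nearly_mono f V k c U \<longleftrightarrow> U \<subseteq> V \<and> (\<forall>v\<in>U. card {w \<in> V - U. f {v, w} \<noteq> c} < k)"

text \<open>A vertex of \<open>A\<close> can deviate from \<open>c\<close> outside
  \<open>U \<union> A\<close> only towards \<open>S\<close>. For a vertex of \<open>U\<close> the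
  count only drops, since edges inside the set are not counted.\<close>

lemma nearly_mono_Un:
  assumes "nearly_mono f V k c U" and "finite V" and "A \<subseteq> V" and "card S < k" and "finite S"
    and "\<And>a b. a \<in> A \<Longrightarrow> b \<in> V - U - A - S \<Longrightarrow> f {a, b} = c"
  shows "nearly_mono f V k c (U \<union> A)"
  unfolding nearly_mono_def
proof (intro conjI ballI)
  show "U \<union> A \<subseteq> V" using assms(1,3) by (auto simp: nearly_mono_def)
  fix v assume v: "v \<in> U \<union> A"
  show "card {w \<in> V - (U \<union> A). f {v, w} \<noteq> c} < k"
  proof (cases "v \<in> U")
    case True
    have "card {w \<in> V - (U \<union> A). f {v, w} \<noteq> c} \<le> card {w \<in> V - U. f {v, w} \<noteq> c}"
      using assms(2) by (intro card_mono) auto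
    then show ?thesis using assms(1) True by (auto simp: nearly_mono_def)
  next
    case False
    then have "{w \<in> V - (U \<union> A). f {v, w} \<noteq> c} \<subseteq> S" using v assms(6) by blast
    then show ?thesis using card_mono[OF assms(5)] assms(4) by (meson le_less_trans)
  qed
qed

text \<open>Deleting fewer than \<open>k\<close> vertices \<open>T\<close> leaves a vertex on each
  side, and the complete bipartite graph between the remainders is connected. A vertex of
  \<open>U\<close> loses fewer than \<open>k\<close> vertices of \<open>A \<union> B\<close> to
  other colours and fewer than \<open>k\<close> to \<open>T\<close>; as \<open>A \<union> B\<close>
  has at least \<open>2 * k\<close>, a neighbour in colour \<open>c\<close> survives.\<close>

lemma bipartite_join_k_connected:
  assumes "nearly_mono f V k c U" and "finite V"
    and "A \<union> B \<union> U = W" and "(A \<union> B) \<inter> U = {}" and "A \<inter> B = {}" and "W \<subseteq> V"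
    and "k \<le> card A" and "k \<le> card B" and "1 \<le> k"
    and "\<And>a b. a \<in> A \<Longrightarrow> b \<in> B \<Longrightarrow> f {a, b} = c"
  shows "k_connected k (W, {e. e \<subseteq> W \<and> card e = 2 \<and> f e = c})"
  unfolding k_connected_def
proof (intro conjI allI impI)
  have fin: "finite W" "finite A" "finite B" "finite U"
    using assms(2,3,6) by (auto intro: finite_subset)
  have "card (A \<union> B) \<le> card W" using fin assms(3) by (intro card_mono) auto
  moreover have "card (A \<union> B) = card A + card B" using fin assms(5) by (simp add: card_Un_disjoint)
  ultimately show "k + 1 \<le> card (verts (W, {e. e \<subseteq> W \<and> card e = 2 \<and> f e = c}))"
    using assms(7,8,9) by (simp add: verts_def)
next
  let ?G = "(W, {e. e \<subseteq> W \<and> card e = 2 \<and> f e = c})"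
  fix T assume T: "T \<subseteq> verts ?G" "card T < k"
  let ?D = "delete_verts ?G T"
  let ?R = "{(x, y). {x, y} \<in> edges ?D}"
  have fin: "finite W" "finite A" "finite B" "finite U"
    using assms(2,3,6) by (auto intro: finite_subset)
  have finT: "finite T" using T(1) fin(1) by (auto simp: verts_def intro: finite_subset)
  have vD: "verts ?D = W - T" by (simp add: delete_verts_def verts_def)
  have R: "(x, y) \<in> ?R" if "x \<in> W - T" "y \<in> W - T" "x \<noteq> y" "f {x, y} = c" for x y
    using that by (auto simp: delete_verts_def edges_def)
  have "\<not> A \<subseteq> T" "\<not> B \<subseteq> T" using card_mono[OF finT, of A] card_mono[OF finT, of B] T(2) assms(7,8) by linarith+
  then obtain a b where ab: "a \<in> A - T" "b \<in> B - T" by blast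
  have R_AB: "(x, y) \<in> ?R" "(y, x) \<in> ?R" if "x \<in> A - T" "y \<in> B - T" for x y
  proof -
    show "(x, y) \<in> ?R" using that assms(3,5,10) by (intro R) auto
    then show "(y, x) \<in> ?R" by (simp add: insert_commute)
  qed
  have reach: "(v, a) \<in> ?R\<^sup>*" if "v \<in> (A \<union> B) - T" for v
  proof (cases "v \<in> A")
    case True
    then have "(v, b) \<in> ?R" using that ab(2) by (intro R_AB(1)) auto
    moreover have "(b, a) \<in> ?R" using ab by (rule R_AB(2))
    ultimately show ?thesis by (meson converse_rtrancl_into_rtrancl r_into_rtrancl)
  next
    case False
    then have "(v, a) \<in> ?R" using that ab(1) by (intro R_AB(2)) auto
    then show ?thesis by (rule r_into_rtrancl)
  qed
  show "connected_graph ?D"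
  proof (rule connected_graph_hub[of a])
    show "a \<in> verts ?D" using ab assms(3) vD by auto
    fix v assume v: "v \<in> verts ?D"
    show "(v, a) \<in> ?R\<^sup>*"
    proof (cases "v \<in> U")
      case False
      then show ?thesis using reach v vD assms(3) by auto
    next
      case True
      let ?M = "{w \<in> V - U. f {v, w} \<noteq> c}"
      have M: "card ?M < k" "finite ?M" using assms(1,2) True by (auto simp: nearly_mono_def)
      have "card (A \<union> B) = card A + card B" using fin assms(5) by (simp add: card_Un_disjoint)
      then have "card (?M \<union> T) < card (A \<union> B)"
        using card_Un_le[of ?M T] M T(2) assms(7,8) by linarith
      then have "\<not> A \<union> B \<subseteq> ?M \<union> T"
        using card_mono[of "?M \<union> T" "A \<union> B"] M finT by auto
      then obtain w where w: "w \<in> A \<union> B" "w \<notin> ?M" "w \<notin> T" by blast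
      then have "(v, w) \<in> ?R" using True v vD assms(3,4,6) by (intro R) auto
      then show ?thesis using reach[of w] w by (meson DiffI converse_rtrancl_into_rtrancl)
    qed
  qed
qed

lemma num_colours_mono:
  assumes "f ` edges H \<subseteq> C" and "finite C" and "card C \<le> s"
  shows "num_colours f H \<le> s"
  using card_mono[OF assms(2,1)] assms(3) by (simp add: num_colours_def)

text \<open>Start from a largest nearly monochromatic \<open>U\<close> with fewer than
  \<open>k\<close> vertices. Adding the smaller side of a cut then has to reach size
  \<open>k\<close>, and both summands are at most \<open>k - 1\<close>.\<close>

lemma nearly_mono_exists:
  fixes n k c :: nat
  assumes "f \<in> colourings n 3" and "c \<in> {1..3}" and "1 \<le> k" and "2 * k \<le> n"
    and none: "\<And>H. H \<in> admissible f n 2 k \<Longrightarrow> card (verts H) < n - k + 1"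
  obtains U where "nearly_mono f {1..n} k c U" "k \<le> card U" "card U + 2 \<le> 2 * k"
proof -
  let ?V = "{1..n}"
  let ?P = "\<lambda>U. nearly_mono f ?V k c U \<and> card U < k"
  have "?P {}" using assms(3) by (simp add: nearly_mono_def)
  moreover have "\<forall>U. ?P U \<longrightarrow> card U < k" by simp
  ultimately have "\<exists>U. ?P U \<and> (\<forall>U'. ?P U' \<longrightarrow> card U' \<le> card U)"
    by (rule ex_has_greatest_nat[of ?P "{}" card k])
  then obtain U where U: "?P U" and max: "\<And>U'. ?P U' \<Longrightarrow> card U' \<le> card U"
    by blast
  have UV: "U \<subseteq> ?V" "finite U" using U by (auto simp: nearly_mono_def intro: finite_subset)
  let ?W = "?V - U"
  let ?E = "{e. e \<subseteq> ?W \<and> card e = 2 \<and> f e \<noteq> c}"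
  have cW: "card ?W = n - card U" using UV by (simp add: card_Diff_subset)
  have f3: "f e \<in> {1..3}" if "e \<subseteq> ?V" "card e = 2" for e
    using assms(1) that by (auto simp: colourings_def complete_graph_def edges_def)
  have not_con: "\<not> k_connected k (?W, ?E)"
  proof
    assume "k_connected k (?W, ?E)"
    moreover have "num_colours f (?W, ?E) \<le> 2"
    proof (rule num_colours_mono)
      show "f ` edges (?W, ?E) \<subseteq> {1..3} - {c}"
      proof (rule image_subsetI)
        fix e assume "e \<in> edges (?W, ?E)"
        then have "e \<subseteq> ?V" "card e = 2" "f e \<noteq> c" by (auto simp: edges_def)
        then show "f e \<in> {1..3} - {c}" using f3 by blast
      qed
      show "card ({1..3} - {c}) \<le> 2" using assms(2) by (simp add: card_Diff_singleton)
    qed simp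
    moreover have "is_subgraph (?W, ?E) (complete_graph n)"
      by (auto simp: is_subgraph_def complete_graph_def verts_def edges_def)
    ultimately have "card ?W < n - k + 1"
      using none[of "(?W, ?E)"] by (simp add: admissible_def verts_def)
    then show False using cW U assms(3,4) by linarith
  qed
  have big: "k + 1 \<le> card ?W" using cW U assms(4) by linarith
  have finW: "finite ?W" by simp
  obtain S A B where S: "S \<subseteq> ?W" "card S < k" and AB: "A \<union> B = ?W - S"
      "A \<inter> B = {}" "A \<noteq> {}" "card A \<le> card B" and no: "\<forall>a\<in>A. \<forall>b\<in>B. {a, b} \<notin> ?E"
    using not_k_connected_cut[OF not_con big] .
  have fin: "finite S" "finite A" "finite B"
    using finite_subset[OF S(1) finW] finite_Un[of A B] finW unfolding AB(1) by simp_all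
  have c: "f {a, b} = c" if "a \<in> A" "b \<in> B" for a b
  proof -
    have "a \<noteq> b" "{a, b} \<subseteq> ?W" using that AB(1,2) by auto
    then show ?thesis using bspec[OF bspec[OF no that(1)] that(2)] by auto
  qed
  \<comment> \<open>Otherwise colour \<open>c\<close> is \<open>k\<close>-connected on the
    complement of \<open>S\<close>, which contains \<open>U\<close> and has at least
    \<open>n - k + 1\<close> vertices, against \<open>none\<close>.\<close>
  have "card A < k"
  proof (rule ccontr)
    assume A: "\<not> card A < k"
    let ?X = "?V - S"
    let ?H = "(?X, {e. e \<subseteq> ?X \<and> card e = 2 \<and> f e = c})"
    have cX: "card ?X = n - card S" using S fin by (subst card_Diff_subset) auto
    have "A \<union> B \<union> U = ?X" "(A \<union> B) \<inter> U = {}"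
      using AB(1) UV(1) S(1) by blast+
    moreover have "k \<le> card A" "k \<le> card B" using A AB(4) by linarith+
    ultimately have "k_connected k ?H"
      using U AB(2) c assms(3) by (intro bipartite_join_k_connected[of f ?V k c U A B]) auto
    moreover have "num_colours f ?H \<le> 2"
      by (intro num_colours_mono[of _ _ "{c}"]) (auto simp: edges_def)
    moreover have "is_subgraph ?H (complete_graph n)"
      by (auto simp: is_subgraph_def complete_graph_def verts_def edges_def)
    ultimately have "card ?X < n - k + 1"
      using none[of ?H] by (simp add: admissible_def verts_def)
    then show False using cX S(2) assms(3,4) by linarith
  qed
  have "nearly_mono f ?V k c (U \<union> A)"
    using U S fin AB c by (intro nearly_mono_Un[where S = S]) auto
  moreover have cUA: "card (U \<union> A) = card U + card A"
    using UV fin AB(1) by (intro card_Un_disjoint) auto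
  moreover have "card A > 0" using AB(3) fin by (simp add: card_gt_0_iff)
  ultimately have "k \<le> card (U \<union> A)" using max[of "U \<union> A"] by force
  then show thesis
    using that \<open>nearly_mono f ?V k c (U \<union> A)\<close> cUA U \<open>card A < k\<close> by simp
qed

section \<open>Disjointness of the three sets and the count of edges between them\<close>

lemma nearly_mono_disjoint:
  assumes "nearly_mono f V k c X" and "nearly_mono f V k d Y" and "c \<noteq> d" and "finite V"
    and "card X + 2 \<le> 2 * k" and "card Y + 2 \<le> 2 * k" and "6 * k \<le> card V + 6"
  shows "X \<inter> Y = {}"
proof (rule ccontr)
  assume "X \<inter> Y \<noteq> {}"
  then obtain v where v: "v \<in> X" "v \<in> Y" by blast
  let ?M = "{w \<in> V - X. f {v, w} \<noteq> c}" and ?N = "{w \<in> V - Y. f {v, w} \<noteq> d}"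
  have fin: "finite X" "finite Y" using assms(1,2,4) by (auto simp: nearly_mono_def intro: finite_subset)
  \<comment> \<open>Every edge from the common vertex \<open>v\<close> misses \<open>c\<close> or
    \<open>d\<close>, so this covers \<open>V\<close>. Counting \<open>v\<close> only once bounds
    the cover by (2k - 2) + (2k - 3) + 2(k - 1) = 6k - 7, just below the assumed 6k - 6.\<close>
  have "V \<subseteq> (X \<union> (Y - {v})) \<union> (?M \<union> ?N)" using assms(3) v by auto
  then have "card V \<le> card ((X \<union> (Y - {v})) \<union> (?M \<union> ?N))"
    using fin assms(4) by (intro card_mono) auto
  also have "\<dots> \<le> card X + card (Y - {v}) + (card ?M + card ?N)"
    by (meson add_mono card_Un_le le_trans)
  finally have "card V \<le> card X + card (Y - {v}) + (card ?M + card ?N)" .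
  moreover have "card ?M < k" "card ?N < k" using assms(1,2) v by (auto simp: nearly_mono_def)
  moreover have "card (Y - {v}) < card Y" using v(2) fin by (intro psubset_card_mono) auto
  ultimately show False using assms(5-7) by linarith
qed

text \<open>For disjoint sets this is a number of edges; as a sum over \<open>X\<close> it can be
  bounded term by term through \<open>nearly_mono\<close>.\<close>

definition deviation :: "('a set \<Rightarrow> nat) \<Rightarrow> nat \<Rightarrow> 'a set \<Rightarrow> 'a set \<Rightarrow> nat" where
  "deviation f c X Y = (\<Sum>x\<in>X. card {y \<in> Y. f {x, y} \<noteq> c})"

text \<open>No edge has both colours, so each pair is counted from at least one end; the swap in the
  proof puts the pairs counted from \<open>Y\<close> back into \<open>X \<times> Y\<close>.\<close>

lemma deviation_add:
  assumes "finite X" and "finite Y" and "c \<noteq> d"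
  shows "card X * card Y \<le> deviation f c X Y + deviation f d Y X"
proof -
  let ?P = "SIGMA x:X. {y \<in> Y. f {x, y} \<noteq> c}" and ?Q = "SIGMA y:Y. {x \<in> X. f {y, x} \<noteq> d}"
  have fin: "finite ?P" "finite ?Q" using assms by auto
  have "X \<times> Y \<subseteq> ?P \<union> prod.swap ` ?Q"
    using assms(3) by (force simp: insert_commute image_iff)
  then have "card (X \<times> Y) \<le> card (?P \<union> prod.swap ` ?Q)"
    using fin by (intro card_mono) auto
  also have "\<dots> \<le> card ?P + card ?Q"
    using card_Un_le[of ?P "prod.swap ` ?Q"] card_image_le[OF fin(2), of prod.swap] by linarith
  finally show ?thesis using assms by (simp add: deviation_def card_cartesian_product)
qed

text \<open>For each \<open>x\<close> the two counts concern disjoint parts of the outside of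
  \<open>X\<close>, so together they stay below \<open>k\<close>.\<close>

lemma deviation_le:
  assumes "nearly_mono f V k c X" and "finite V" and "Y \<union> Z \<subseteq> V" and "Y \<inter> Z = {}"
    and "X \<inter> (Y \<union> Z) = {}"
  shows "deviation f c X Y + deviation f c X Z \<le> card X * (k - 1)"
proof -
  have fin: "finite Y" "finite Z" using assms(2,3) by (auto intro: finite_subset)
  have "card {y \<in> Y. f {x, y} \<noteq> c} + card {y \<in> Z. f {x, y} \<noteq> c} \<le> k - 1" if "x \<in> X" for x
  proof -
    have "card {y \<in> Y. f {x, y} \<noteq> c} + card {y \<in> Z. f {x, y} \<noteq> c}
        = card ({y \<in> Y. f {x, y} \<noteq> c} \<union> {y \<in> Z. f {x, y} \<noteq> c})"
      using fin assms(4) by (intro card_Un_disjoint[symmetric]) auto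
    also have "\<dots> \<le> card {y \<in> V - X. f {x, y} \<noteq> c}"
      using assms(2,3,5) by (intro card_mono) auto
    also have "\<dots> \<le> k - 1" using assms(1) that by (fastforce simp: nearly_mono_def)
    finally show ?thesis .
  qed
  then have "(\<Sum>x\<in>X. card {y \<in> Y. f {x, y} \<noteq> c} + card {y \<in> Z. f {x, y} \<noteq> c})
      \<le> of_nat (card X) * (k - 1)"
    by (rule sum_bounded_above)
  then show ?thesis by (simp add: deviation_def sum.distrib)
qed

lemma admissible_large_exists:
  fixes n k :: nat
  assumes "f \<in> colourings n 3" and "1 \<le> k" and "2 * k \<le> n" and "6 * k \<le> n + 6"
  obtains H where "H \<in> admissible f n 2 k" "n - k + 1 \<le> card (verts H)"
proof (rule ccontr)
  assume "\<not> thesis"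
  then have none: "\<And>H. H \<in> admissible f n 2 k \<Longrightarrow> card (verts H) < n - k + 1"
    using that not_le by blast
  let ?V = "{1..n}"
  have ex: "\<exists>U. nearly_mono f ?V k c U \<and> k \<le> card U \<and> card U + 2 \<le> 2 * k" if "c \<in> {1..3}" for c
    using nearly_mono_exists[OF assms(1) that assms(2,3) none] by blast
  obtain X where X: "nearly_mono f ?V k 1 X" "k \<le> card X" "card X + 2 \<le> 2 * k"
    using ex[of 1] by auto
  obtain Y where Y: "nearly_mono f ?V k 2 Y" "k \<le> card Y" "card Y + 2 \<le> 2 * k"
    using ex[of 2] by auto
  obtain Z where Z: "nearly_mono f ?V k 3 Z" "k \<le> card Z" "card Z + 2 \<le> 2 * k"
    using ex[of 3] by auto
  have sub: "X \<subseteq> ?V" "Y \<subseteq> ?V" "Z \<subseteq> ?V" using X Y Z by (auto simp: nearly_mono_def)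
  then have fin: "finite X" "finite Y" "finite Z" by (auto intro: finite_subset)
  have disj: "X \<inter> Y = {}" "X \<inter> Z = {}" "Y \<inter> Z = {}"
    using nearly_mono_disjoint[OF X(1) Y(1)] nearly_mono_disjoint[OF X(1) Z(1)]
      nearly_mono_disjoint[OF Y(1) Z(1)] X(3) Y(3) Z(3) assms(4) by simp_all
  define m where "m = k - 1"
  have "deviation f 1 X Y + deviation f 1 X Z \<le> card X * m"
    unfolding m_def using sub disj by (intro deviation_le[OF X(1)]) auto
  moreover have "deviation f 2 Y X + deviation f 2 Y Z \<le> card Y * m"
    unfolding m_def using sub disj by (intro deviation_le[OF Y(1)]) auto
  moreover have "deviation f 3 Z X + deviation f 3 Z Y \<le> card Z * m"
    unfolding m_def using sub disj by (intro deviation_le[OF Z(1)]) auto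
  moreover have "card X * card Y \<le> deviation f 1 X Y + deviation f 2 Y X"
    "card X * card Z \<le> deviation f 1 X Z + deviation f 3 Z X"
    "card Y * card Z \<le> deviation f 2 Y Z + deviation f 3 Z Y"
    using fin by (auto intro: deviation_add)
  ultimately have upper: "card X * card Y + card X * card Z + card Y * card Z
      \<le> card X * m + card Y * m + card Z * m"
    by linarith
  have mult: "x * k \<le> x * y" if "k \<le> y" for x y :: nat
    using that by simp
  \<comment> \<open>Each size occurs in two products whose other factor is at least
    \<open>k\<close>. Hence twice the left side of \<open>upper\<close> is at least 2k times the sum
    of the sizes, while twice its right side is strictly smaller, as the sizes are positive.\<close>
  have "card X * k + card X * k \<le> card X * card Y + card X * card Z"
    "card Y * k + card Y * k \<le> card X * card Y + card Y * card Z"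
    "card Z * k + card Z * k \<le> card X * card Z + card Y * card Z"
    using mult[OF X(2)] mult[OF Y(2)] mult[OF Z(2)] by (metis add_mono mult.commute)+
  moreover have "card X * m < card X * k" "card Y * m < card Y * k" "card Z * m < card Z * k"
    unfolding m_def using X(2) Y(2) Z(2) assms(2) by auto
  ultimately show False using upper by linarith
qed

section \<open>The upper bound\<close>

text \<open>Edges X-Y get 1, Y-Z get 2 and Z-X get 3. So \<open>X\<close> deviates from 1 only
  towards \<open>Z\<close>, \<open>Y\<close> from 2 only towards \<open>X\<close>, and
  \<open>Z\<close> from 3 only towards \<open>Y\<close>. The final 1 is the default for edges
  avoiding all three sets.\<close>

definition cyclic_colouring :: "'a set \<Rightarrow> 'a set \<Rightarrow> 'a set \<Rightarrow> 'a set \<Rightarrow> nat" where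
  "cyclic_colouring X Y Z e =
     (if e \<inter> X \<noteq> {} \<and> e \<inter> Z = {} then 1
      else if e \<inter> Y \<noteq> {} \<and> e \<inter> X = {} then 2
      else if e \<inter> Z \<noteq> {} then 3
      else 1)"

lemma cyclic_colouring_in_colourings: "cyclic_colouring X Y Z \<in> colourings n 3"
  by (auto simp: cyclic_colouring_def colourings_def)

text \<open>With colour \<open>c\<close> absent from \<open>H\<close>, a vertex of \<open>X\<close>
  in \<open>H\<close> has all its neighbours in \<open>Y\<close>, too few for
  \<open>k_connected_degree\<close>.\<close>

lemma avoid_low_degree_set:
  assumes "k_connected k H" and "finite (verts H)" and "\<forall>e\<in>edges H. e \<subseteq> verts H"
    and "finite Y" and "card Y < k" and "c \<notin> f ` edges H"
    and "\<And>v w. v \<in> X \<Longrightarrow> w \<notin> Y \<Longrightarrow> f {v, w} = c"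
  shows "verts H \<inter> X = {}"
proof (rule ccontr)
  assume "verts H \<inter> X \<noteq> {}"
  then obtain v where v: "v \<in> verts H" "v \<in> X" by blast
  have "{w. {v, w} \<in> edges H} - {v} \<subseteq> Y" using assms(6,7) v(2) by blast
  then show False
    using k_connected_degree[OF assms(1-3) v(1)] card_mono[OF assms(4)] assms(5)
    by (meson le_trans not_le)
qed

text \<open>The three sets are consecutive blocks of \<open>k - 1\<close> vertices ending at 3k - 3,
  hence inside \<open>{1..n}\<close>, and empty for k = 1. One of the three colours is absent from
  \<open>H\<close>, so \<open>H\<close> avoids a whole block.\<close>

lemma cyclic_colouring_admissible_le:
  fixes n k :: nat
  defines "X \<equiv> {1..<k}" and "Y \<equiv> {k..<2 * k - 1}" and "Z \<equiv> {2 * k - 1..<3 * k - 2}"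
  assumes H: "H \<in> admissible (cyclic_colouring X Y Z) n 2 k" and k: "1 \<le> k" "3 * k \<le> n + 3"
  shows "card (verts H) \<le> n - k + 1"
proof -
  let ?f = "cyclic_colouring X Y Z"
  have sub: "verts H \<subseteq> {1..n}" and ed: "\<forall>e\<in>edges H. e \<subseteq> verts H" and con: "k_connected k H"
    and few: "card (?f ` edges H) \<le> 2"
    using H by (auto simp: admissible_def is_subgraph_def complete_graph_def verts_def num_colours_def)
  have fin: "finite (verts H)" using sub by (auto intro: finite_subset)
  have disj: "X \<inter> Y = {}" "Y \<inter> Z = {}" "X \<inter> Z = {}"
    by (auto simp: X_def Y_def Z_def)
  have size: "card X = k - 1" "card Y = k - 1" "card Z = k - 1"
    by (auto simp: X_def Y_def Z_def)
  have inV: "X \<subseteq> {1..n}" "Y \<subseteq> {1..n}" "Z \<subseteq> {1..n}"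
    using k by (auto simp: X_def Y_def Z_def)
  have fins: "finite X" "finite Y" "finite Z" by (auto simp: X_def Y_def Z_def)
  have less: "k - 1 < k" using k by simp
  have bound: ?thesis if "T \<subseteq> {1..n}" "card T = k - 1" "verts H \<inter> T = {}" for T
  proof -
    have "card (verts H) \<le> card ({1..n} - T)" using sub that by (intro card_mono) auto
    also have "\<dots> = n - (k - 1)" using that(1,2) by (subst card_Diff_subset) (auto intro: finite_subset)
    finally show ?thesis using k by linarith
  qed
  have "\<not> {1, 2, 3} \<subseteq> ?f ` edges H"
  proof
    assume "{1, 2, 3} \<subseteq> ?f ` edges H"
    moreover have "finite (?f ` edges H)"
      by (rule finite_subset[of _ "{1, 2, 3}"]) (auto simp: cyclic_colouring_def)
    ultimately have "card {1, 2, 3 :: nat} \<le> card (?f ` edges H)" by (intro card_mono)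
    then show False using few by simp
  qed
  then consider "1 \<notin> ?f ` edges H" | "2 \<notin> ?f ` edges H" | "3 \<notin> ?f ` edges H" by blast
  then show ?thesis
  proof cases
    case 1
    have "verts H \<inter> X = {}"
      using disj size less by (intro avoid_low_degree_set[OF con fin ed fins(3) _ 1])
        (auto simp: cyclic_colouring_def)
    then show ?thesis using bound inV size by blast
  next
    case 2
    have "verts H \<inter> Y = {}"
      using disj size less by (intro avoid_low_degree_set[OF con fin ed fins(1) _ 2])
        (auto simp: cyclic_colouring_def)
    then show ?thesis using bound inV size by blast
  next
    case 3
    have "verts H \<inter> Z = {}"
      using disj size less by (intro avoid_low_degree_set[OF con fin ed fins(2) _ 3])
        (auto simp: cyclic_colouring_def)
    then show ?thesis using bound inV size by blast
  qed
qed

theorem theorem1p2: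
  fixes n k :: nat
  assumes "n \<ge> 2" and "k \<ge> 1"
    and "int n \<ge> 13 * int k - 15"
  shows "int (min_max_order n 3 2 k) = int n - int k + 1"
proof -
  \<comment> \<open>For k = 1 the bound \<open>2 * k \<le> n\<close> comes from
    \<open>n \<ge> 2\<close>; for larger \<open>k\<close> all four follow from n \<ge> 13k -
    15.\<close>
  have nk: "2 * k \<le> n" "6 * k \<le> n + 6" "3 * k \<le> n + 3" "k \<le> n"
    using assms by linarith+
  have lower: "n - k + 1 \<le> max_order f n 2 k" if f: "f \<in> colourings n 3" for f
  proof -
    obtain H where H: "H \<in> admissible f n 2 k" "n - k + 1 \<le> card (verts H)"
      using admissible_large_exists[OF f assms(2) nk(1,2)] .
    then show ?thesis
      using Max_ge[OF finite_orders, of "card (verts H)" f n 2 k] by (auto simp: max_order_def)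
  qed
  define f where "f = cyclic_colouring {1..<k} {k..<2 * k - 1} {2 * k - 1..<3 * k - 2}"
  have f: "f \<in> colourings n 3"
    unfolding f_def by (rule cyclic_colouring_in_colourings)
  \<comment> \<open>If no subgraph is admissible, the default value 0 satisfies the bound.\<close>
  have "max_order f n 2 k \<le> n - k + 1"
    using cyclic_colouring_admissible_le[of _ k n] assms(2) nk(3) finite_orders[of f n 2 k]
    by (auto simp: max_order_def f_def)
  then have "max_order f n 2 k = n - k + 1"
    using lower[OF f] by simp
  then have "min_max_order n 3 2 k = n - k + 1"
    unfolding min_max_order_def using lower f by (intro Min_eqI finite_max_orders) force+
  then show ?thesis using nk(4) by simp
qed

end
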